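(* Let $M$ be a matroid of rank $n$, where $n \ge 2$, let $B_1, \dots, B_n$ be pairwise disjoint bases of $M$, and let $\alpha = 3\lceil \log n \rceil$. Suppose $\alpha$-element subsets $S_1 \subseteq B_1, \dots, S_n \subseteq B_n$ are chosen independently, each $S_i$ uniformly at random among the $\alpha$-element subsets of $B_i$. Then, with probability at least $\tfrac12$, the collection $(S_1, \dots, S_n)$ contains a transversal basis, i.e. there is a basis of $M$ containing exactly one element from each of $S_1,\dots,S_n$.
   Context: Here $\log$ denotes the natural logarithm.
   Formalization: The subsets S_i have size min(α, n) instead of α: for n = 2, 3, 4, 5, 8 one has α > n = |B_i|, so no α-element subsets of B_i exist and S_i = B_i is taken; for all other n the size is exactly α. *)

theory Defs
  imports "HOL-Probability.Probability"
begin

definition matroid :: "'a set \<Rightarrow> ('a set \<Rightarrow> bool) \<Rightarrow> bool" where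
  "matroid E indep \<longleftrightarrow>
     finite E \<and>
     (\<forall>X. indep X \<longrightarrow> X \<subseteq> E) \<and>
     indep {} \<and>
     (\<forall>X Y. indep X \<and> Y \<subseteq> X \<longrightarrow> indep Y) \<and>
     (\<forall>X Y. indep X \<and> indep Y \<and> card X < card Y \<longrightarrow> (\<exists>y\<in>Y - X. indep (insert y X)))"

definition matroid_basis :: "'a set \<Rightarrow> ('a set \<Rightarrow> bool) \<Rightarrow> 'a set \<Rightarrow> bool" where
  "matroid_basis E indep X \<longleftrightarrow>
     X \<subseteq> E \<and> indep X \<and> (\<forall>Y. Y \<subseteq> E \<and> indep Y \<and> X \<subseteq> Y \<longrightarrow> Y = X)"

definition matroid_rank :: "'a set \<Rightarrow> ('a set \<Rightarrow> bool) \<Rightarrow> nat" where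
  "matroid_rank E indep = Max (card ` {X. X \<subseteq> E \<and> indep X})"

definition has_transversal_basis ::
  "'a set \<Rightarrow> ('a set \<Rightarrow> bool) \<Rightarrow> nat \<Rightarrow> (nat \<Rightarrow> 'a set) \<Rightarrow> bool" where
  "has_transversal_basis E indep n S \<longleftrightarrow>
     (\<exists>T. matroid_basis E indep T \<and> T \<subseteq> (\<Union>i\<in>{1..n}. S i) \<and>
          (\<forall>i\<in>{1..n}. card (T \<inter> S i) = 1))"

end

theory Submission
  imports Defs
begin

text \<open>By Rado's theorem, a failure means that some union of t of the sets S i has rank at most
  q = t - 1. If the elements of the S i are revealed one at a time, the random variable
  C(n - r, n - q), where r is the rank of what has been revealed, shrinks in expectation by a
  factor q / n at each step, because a set of rank r spans at most r elements of a basis. It starts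
  at C(n, q) and is at least 1 whenever r \<le> q, so the failure has probability at most
  C(n, q) (q / n)^(k t), exactly as for Hall's condition in a random bipartite graph. A union bound
  over the index sets finishes the proof.\<close>

section \<open>Double counting over subsets of fixed size\<close>

text \<open>Both sides sum over pairs of a set and a marked element, and deleting the mark is a
  bijection. In probabilistic terms, a uniform \<open>Suc l\<close>-subset is a uniform
  \<open>l\<close>-subset plus one uniform new element, so a random subset can be revealed element
  by element.\<close>

lemma times_sum_subsets_card_Suc:
  fixes f :: "'a set \<Rightarrow> real"
  assumes "finite B"
  shows "real (Suc l) * (\<Sum>S | S \<subseteq> B \<and> card S = Suc l. f S)
       = (\<Sum>S | S \<subseteq> B \<and> card S = l. \<Sum>x\<in>B - S. f (insert x S))"
proof -
  have fin: "finite {S. S \<subseteq> B \<and> card S = m}" for m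
    using assms by simp
  have finS: "finite S" if "S \<subseteq> B" for S using that assms finite_subset by blast
  have "real (Suc l) * (\<Sum>S | S \<subseteq> B \<and> card S = Suc l. f S)
      = (\<Sum>S | S \<subseteq> B \<and> card S = Suc l. \<Sum>x\<in>S. f S)"
    by (simp add: sum_distrib_left)
  also have "\<dots> = (\<Sum>(S, x)\<in>(SIGMA S:{S. S \<subseteq> B \<and> card S = Suc l}. S). f S)"
    by (rule sum.Sigma) (auto intro: fin finS)
  also have "\<dots> = (\<Sum>(S, x)\<in>(SIGMA S:{S. S \<subseteq> B \<and> card S = l}. B - S). f (insert x S))"
    by (rule sum.reindex_bij_witness[where i = "\<lambda>(S, x). (insert x S, x)"
          and j = "\<lambda>(S, x). (S - {x}, x)"])
       (auto simp: finS insert_absorb card_insert_if)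
  also have "\<dots> = (\<Sum>S | S \<subseteq> B \<and> card S = l. \<Sum>x\<in>B - S. f (insert x S))"
    by (rule sum.Sigma[symmetric]) (auto intro: fin simp: assms)
  finally show ?thesis .
qed

section \<open>The rank function of a matroid\<close>

context
  fixes E :: "'a set" and indep :: "'a set \<Rightarrow> bool"
  assumes matroid: "matroid E indep"
begin

text \<open>Letting the ground set argument of \<open>matroid_rank\<close> vary turns it into a rank
  function on arbitrary sets.\<close>

abbreviation (input) rk :: "'a set \<Rightarrow> nat" where
  "rk X \<equiv> matroid_rank X indep"

lemma indep_finite: "indep X \<Longrightarrow> finite X"
  using matroid unfolding matroid_def by (meson finite_subset)

lemma indep_subset: "indep X \<Longrightarrow> Y \<subseteq> X \<Longrightarrow> indep Y"
  using matroid unfolding matroid_def by blast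

lemma indep_exchange:
  "indep X \<Longrightarrow> indep Y \<Longrightarrow> card X < card Y \<Longrightarrow> \<exists>y\<in>Y - X. indep (insert y X)"
  using matroid unfolding matroid_def by blast

lemma finite_indep_subsets: "finite {Y. Y \<subseteq> X \<and> indep Y}"
proof (rule finite_subset)
  show "{Y. Y \<subseteq> X \<and> indep Y} \<subseteq> Pow E" using matroid unfolding matroid_def by blast
  show "finite (Pow E)" using matroid unfolding matroid_def by blast
qed

lemma card_le_matroid_rank: "Y \<subseteq> X \<Longrightarrow> indep Y \<Longrightarrow> card Y \<le> rk X"
  unfolding matroid_rank_def by (rule Max_ge) (auto simp: finite_indep_subsets)

lemma matroid_rank_attained:
  obtains Y where "Y \<subseteq> X" "indep Y" "card Y = rk X"
proof -
  have "indep {}" using matroid unfolding matroid_def by blast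
  then have "card ` {Y. Y \<subseteq> X \<and> indep Y} \<noteq> {}" by blast
  then have "rk X \<in> card ` {Y. Y \<subseteq> X \<and> indep Y}"
    unfolding matroid_rank_def by (intro Max_in) (auto simp: finite_indep_subsets)
  then show thesis using that by auto
qed

lemma matroid_rank_mono: "X \<subseteq> Y \<Longrightarrow> rk X \<le> rk Y"
  by (metis card_le_matroid_rank matroid_rank_attained order_trans)

lemma matroid_rank_le_card: "finite X \<Longrightarrow> rk X \<le> card X"
  by (metis card_mono matroid_rank_attained)

lemma matroid_rank_indep: "indep X \<Longrightarrow> rk X = card X"
  by (simp add: antisym card_le_matroid_rank indep_finite matroid_rank_le_card)

lemma matroid_rank_le_rank: "rk X \<le> rk E"
  using matroid unfolding matroid_def
  by (metis card_le_matroid_rank matroid_rank_attained)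

lemma indep_of_card_le_rank:
  assumes "finite X" "card X \<le> rk X"
  shows "indep X"
  by (metis assms card_seteq matroid_rank_attained)

text \<open>Induction on the deficit \<open>rk X - card Y\<close>: exchange against a maximum
  independent subset of \<open>X\<close> supplies one new element at a time.\<close>

lemma indep_extends_to_rank:
  assumes "indep Y" "Y \<subseteq> X"
  obtains Z where "Y \<subseteq> Z" "Z \<subseteq> X" "indep Z" "card Z = rk X"
proof -
  have "\<exists>Z. Y \<subseteq> Z \<and> Z \<subseteq> X \<and> indep Z \<and> card Z = rk X"
    using assms
  proof (induction "rk X - card Y" arbitrary: Y)
    case 0
    then show ?case using card_le_matroid_rank[of Y X] by auto
  next
    case (Suc d)
    obtain W where W: "W \<subseteq> X" "indep W" "card W = rk X" by (rule matroid_rank_attained)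
    with Suc have "card Y < card W" by simp
    then obtain y where y: "y \<in> W - Y" "indep (insert y Y)"
      using indep_exchange Suc.prems W by blast
    moreover have "d = rk X - card (insert y Y)"
      using Suc.hyps(2) y indep_finite[OF Suc.prems(1)] by simp
    ultimately show ?case
      using Suc.hyps(1)[of "insert y Y"] Suc.prems W by auto
  qed
  then show thesis using that by blast
qed

text \<open>A maximum independent subset of \<open>A \<inter> B\<close> extends to a maximum one
  \<open>Z\<close> of \<open>A \<union> B\<close>; the claim is inclusion-exclusion for
  \<open>Z \<inter> A\<close> and \<open>Z \<inter> B\<close>.\<close>

lemma matroid_rank_submodular: "rk (A \<union> B) + rk (A \<inter> B) \<le> rk A + rk B"
proof -
  obtain Y where Y: "Y \<subseteq> A \<inter> B" "indep Y" "card Y = rk (A \<inter> B)"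
    by (rule matroid_rank_attained)
  obtain Z where Z: "Y \<subseteq> Z" "Z \<subseteq> A \<union> B" "indep Z" "card Z = rk (A \<union> B)"
    using indep_extends_to_rank[of Y "A \<union> B"] Y by blast
  have fin: "finite Z" using Z indep_finite by blast
  have "Z = (Z \<inter> A) \<union> (Z \<inter> B)" using Z by blast
  then have "card Z + card ((Z \<inter> A) \<inter> (Z \<inter> B)) = card (Z \<inter> A) + card (Z \<inter> B)"
    using card_Un_Int[of "Z \<inter> A" "Z \<inter> B"] fin by simp
  moreover have "card Y \<le> card ((Z \<inter> A) \<inter> (Z \<inter> B))"
    using Y Z fin by (intro card_mono) auto
  moreover have "card (Z \<inter> A) \<le> rk A" "card (Z \<inter> B) \<le> rk B"
    using indep_subset[OF Z(3)] by (auto intro!: card_le_matroid_rank)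
  ultimately show ?thesis using Y Z by linarith
qed

lemma matroid_rank_insert_le: "rk (insert x X) \<le> Suc (rk X)"
  using matroid_rank_submodular[of X "{x}"] matroid_rank_le_card[of "{x}"] by simp

text \<open>Elements of \<open>C\<close> are added singly: \<open>X \<union> C\<close> and
  \<open>insert x X\<close> both have the rank of \<open>X\<close>, and so does their intersection,
  hence by submodularity their union.\<close>

lemma matroid_rank_Un_spanned:
  assumes "finite C" "\<And>x. x \<in> C \<Longrightarrow> rk (insert x X) = rk X"
  shows "rk (X \<union> C) = rk X"
  using assms
proof (induction C rule: finite_induct)
  case (insert x C)
  have "rk ((X \<union> C) \<union> insert x X) + rk ((X \<union> C) \<inter> insert x X) \<le> rk (X \<union> C) + rk (insert x X)"
    by (rule matroid_rank_submodular)
  moreover have "rk X \<le> rk ((X \<union> C) \<inter> insert x X)" by (rule matroid_rank_mono) auto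
  moreover have "(X \<union> C) \<union> insert x X = X \<union> insert x C" by auto
  moreover have "rk X \<le> rk (X \<union> insert x C)" by (rule matroid_rank_mono) auto
  moreover have "rk (X \<union> C) = rk X" "rk (insert x X) = rk X"
    using insert by auto
  ultimately show ?case by simp
qed simp

text \<open>Adding all spanned elements of \<open>B\<close> to \<open>X\<close> keeps the rank, yet
  these elements are independent. This is the matroid input of the potential argument.\<close>

lemma card_spanned_indep_le:
  assumes "indep B"
  shows "card {x \<in> B. rk (insert x X) = rk X} \<le> rk X"
proof -
  let ?D = "{x \<in> B. rk (insert x X) = rk X}"
  have "card ?D \<le> rk (X \<union> ?D)"
    using assms by (intro card_le_matroid_rank) (auto intro: indep_subset)
  also have "\<dots> = rk X"
    using indep_finite[OF assms] by (intro matroid_rank_Un_spanned) auto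
  finally show ?thesis .
qed

lemma matroid_basis_card:
  assumes "matroid_basis E indep X"
  shows "card X = rk E"
proof -
  obtain Z where "X \<subseteq> Z" "Z \<subseteq> E" "indep Z" "card Z = rk E"
    using indep_extends_to_rank[of X E] assms unfolding matroid_basis_def by blast
  then show ?thesis using assms unfolding matroid_basis_def by blast
qed

lemma matroid_basis_of_card:
  assumes "indep X" "card X = rk E"
  shows "matroid_basis E indep X"
  unfolding matroid_basis_def
proof (intro conjI allI impI)
  show "X \<subseteq> E" using assms matroid unfolding matroid_def by blast
  fix Y assume "Y \<subseteq> E \<and> indep Y \<and> X \<subseteq> Y"
  then show "Y = X"
    using assms card_le_matroid_rank[of Y E] card_seteq[of Y X] indep_finite[of Y] by simp
qed (use assms in simp)

section \<open>Rado's theorem on independent transversals\<close>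

text \<open>Induction on the total size of the sets: elements are deleted while the rank condition
  survives. Once all sets are singletons, the condition for \<open>I\<close> itself forces their
  elements to be distinct and independent.\<close>

theorem Rado:
  fixes A :: "'i \<Rightarrow> 'a set"
  assumes "finite I" "\<And>i. i \<in> I \<Longrightarrow> finite (A i)"
    and "\<And>J. J \<subseteq> I \<Longrightarrow> card J \<le> rk (\<Union>i\<in>J. A i)"
  obtains f where "\<And>i. i \<in> I \<Longrightarrow> f i \<in> A i" "inj_on f I" "indep (f ` I)"
proof -
  have "\<exists>f. (\<forall>i\<in>I. f i \<in> A i) \<and> inj_on f I \<and> indep (f ` I)"
    using assms(2,3)
  proof (induction "\<Sum>i\<in>I. card (A i)" arbitrary: A rule: less_induct)
    case less
    have pos: "1 \<le> card (A i)" if "i \<in> I" for i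
    proof -
      have "1 \<le> rk (A i)" using less.prems(2)[of "{i}"] that by simp
      also have "\<dots> \<le> card (A i)" using less.prems(1)[OF that] by (rule matroid_rank_le_card)
      finally show ?thesis .
    qed
    show ?case
    proof (cases "\<exists>i\<in>I. card (A i) \<ge> 2")
      case False
      then have "\<forall>i\<in>I. card (A i) = 1" using pos by force
      then have "\<forall>i\<in>I. \<exists>x. A i = {x}" by (simp add: card_1_singleton_iff)
      then obtain f where f: "\<And>i. i \<in> I \<Longrightarrow> A i = {f i}" by metis
      have U: "(\<Union>i\<in>I. A i) = f ` I" using f by auto
      have fin: "finite (f ` I)" using assms(1) by simp
      have ge: "card I \<le> rk (f ` I)" using less.prems(2)[of I] U by simp
      have "card (f ` I) = card I"
        using ge matroid_rank_le_card[OF fin] card_image_le[OF assms(1), of f] by linarith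
      then have "inj_on f I" "indep (f ` I)"
        using assms(1) eq_card_imp_inj_on indep_of_card_le_rank[OF fin] ge by auto
      then show ?thesis using f by auto
    next
      case True
      then obtain i where i: "i \<in> I" "2 \<le> card (A i)" by blast
      then obtain x y where xy: "x \<in> A i" "y \<in> A i" "x \<noteq> y"
        by (metis card_le_Suc0_iff_eq less.prems(1) not_less_eq_eq numeral_2_eq_2)
      define A' where "A' z = A(i := A i - {z})" for z
      \<comment> \<open>If deleting \<open>x\<close> and deleting \<open>y\<close> from \<open>A i\<close> both destroyed the rank condition,
        submodularity applied to the two violating unions would contradict it for \<open>A\<close>.\<close>
      have "\<exists>z\<in>{x, y}. \<forall>J\<subseteq>I. card J \<le> rk (\<Union>j\<in>J. A' z j)"
      proof (rule ccontr)
        assume "\<not> ?thesis"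
        then have "\<forall>z\<in>{x,y}. \<exists>J\<subseteq>I. rk (\<Union>j\<in>J. A' z j) < card J"
          by (meson not_le)
        then obtain J K where J: "J \<subseteq> I" "rk (\<Union>j\<in>J. A' x j) < card J"
          and K: "K \<subseteq> I" "rk (\<Union>j\<in>K. A' y j) < card K" by auto
        have mem: "i \<in> L" if "L \<subseteq> I" "rk (\<Union>j\<in>L. A' z j) < card L" for L z
        proof (rule ccontr)
          assume "i \<notin> L"
          then have "A' z j = A j" if "j \<in> L" for j using that by (auto simp: A'_def)
          then have "(\<Union>j\<in>L. A' z j) = (\<Union>j\<in>L. A j)" by simp
          then show False using that less.prems(2)[of L] by simp
        qed
        have iJ: "i \<in> J" and iK: "i \<in> K" using mem J K by blast+
        let ?P = "\<Union>j\<in>J. A' x j" and ?Q = "\<Union>j\<in>K. A' y j"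
        \<comment> \<open>The index \<open>i\<close> is dropped because
          \<open>?P \<inter> ?Q\<close> need not contain \<open>A i\<close>. This costs one, but the
          two strict violations gain two.\<close>
        let ?L = "(J \<inter> K) - {i}"
        have fin: "finite J" "finite K" using J K assms(1) finite_subset by blast+
        have "card (J \<union> K) \<le> rk (\<Union>j\<in>J \<union> K. A j)" using J K by (intro less.prems) auto
        \<comment> \<open>As \<open>x \<noteq> y\<close>, the sets \<open>A i - {x}\<close> and
          \<open>A i - {y}\<close> together still cover \<open>A i\<close>.\<close>
        also have "\<dots> \<le> rk (?P \<union> ?Q)"
        proof (rule matroid_rank_mono, rule subsetI)
          fix w assume "w \<in> (\<Union>j\<in>J \<union> K. A j)"
          then obtain j where "j \<in> J \<union> K" "w \<in> A j" by blast
          then show "w \<in> ?P \<union> ?Q"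
            using iJ iK xy unfolding A'_def by (cases "j = i"; cases "w = x") auto
        qed
        finally have 1: "card (J \<union> K) \<le> rk (?P \<union> ?Q)" .
        have "card ?L \<le> rk (\<Union>j\<in>?L. A j)" using J by (intro less.prems) auto
        also have "\<dots> \<le> rk (?P \<inter> ?Q)"
          by (intro matroid_rank_mono) (auto simp: A'_def)
        finally have 2: "card ?L \<le> rk (?P \<inter> ?Q)" .
        have 3: "Suc (card ?L) = card (J \<inter> K)"
          using iJ iK fin by (metis IntI card_Suc_Diff1 finite_Int)
        show False
          using 1 2 3 J K matroid_rank_submodular[of ?P ?Q] card_Un_Int[OF fin] by linarith
      qed
      then obtain z where z: "z \<in> A i" "\<And>J. J \<subseteq> I \<Longrightarrow> card J \<le> rk (\<Union>j\<in>J. A' z j)"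
        using xy by auto
      have "(\<Sum>j\<in>I. card (A' z j)) < (\<Sum>j\<in>I. card (A j))"
      proof (rule sum_strict_mono_ex1)
        show "\<forall>j\<in>I. card (A' z j) \<le> card (A j)"
          using less.prems(1) by (auto simp: A'_def card_Diff1_le)
        show "\<exists>j\<in>I. card (A' z j) < card (A j)"
          using i z less.prems(1) by (auto simp: A'_def intro!: bexI[of _ i] card_Diff1_less)
      qed (rule assms)
      then have "\<exists>f. (\<forall>i\<in>I. f i \<in> A' z i) \<and> inj_on f I \<and> indep (f ` I)"
        using less.prems(1) z(2) by (intro less.hyps) (auto simp: A'_def)
      moreover have "A' z j \<subseteq> A j" for j by (auto simp: A'_def)
      ultimately show ?thesis by blast
    qed
  qed
  then show thesis using that by blast
qed

section \<open>The potential and its decay under random sampling\<close>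

text \<open>For \<open>q \<le> rk E\<close> this is the number of \<open>q\<close>-subsets of an
  \<open>rk E\<close>-set containing a fixed set of size \<open>rk X\<close>. In the bipartite graph
  analogy it counts the candidate sets that still capture everything revealed.\<close>

abbreviation (input) pot :: "nat \<Rightarrow> 'a set \<Rightarrow> real" where
  "pot q X \<equiv> real ((rk E - rk X) choose (rk E - q))"

text \<open>A spanned \<open>x\<close> leaves the potential unchanged, any other raises the rank to
  \<open>Suc r\<close>. Since \<open>S\<close> itself is spanned, at most \<open>r - l\<close> of
  the \<open>n - l\<close> candidates are wasted.\<close>

lemma sum_potential_insert_le:
  assumes B: "indep B" "card B = rk E" and S: "S \<subseteq> B" "card S < rk E" and q: "q \<le> rk E"
  shows "(\<Sum>x\<in>B - S. pot q (insert x (F \<union> S)))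
       \<le> real (rk E - card S) * (real q / real (rk E)) * pot q (F \<union> S)"
proof -
  let ?X = "F \<union> S"
  define n r l where "n = rk E" and "r = rk ?X" and "l = card S"
  define D where "D = {x \<in> B. rk (insert x ?X) = rk ?X}"
  define \<phi> where "\<phi> j = real ((n - j) choose (n - q))" for j
  have finB: "finite B" using B indep_finite by blast
  have SD: "S \<subseteq> D" using S by (auto simp: D_def insert_absorb)
  have DB: "D \<subseteq> B" by (auto simp: D_def)
  have fin: "finite D" "finite S" using finB SD DB finite_subset by metis+
  have dr: "card D \<le> r" unfolding D_def r_def using card_spanned_indep_le[OF B(1)] .
  have rn: "r \<le> n" unfolding r_def n_def by (rule matroid_rank_le_rank)
  have ld: "l \<le> card D" unfolding l_def using SD fin by (simp add: card_mono)
  have ln: "l < n" using S unfolding l_def n_def by simp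
  have \<phi>_anti: "\<phi> (Suc j) \<le> \<phi> j" for j
    unfolding \<phi>_def by (intro of_nat_mono binomial_right_mono) simp_all
  \<comment> \<open>Binomial absorption; for \<open>r > q\<close> both sides vanish, the right one
    by truncated subtraction.\<close>
  have \<phi>_step: "real (n - r) * \<phi> (Suc r) = real (q - r) * \<phi> r"
  proof -
    have "n - r - (n - q) = q - r" using rn q unfolding n_def by linarith
    then have "(q - r) * ((n - r) choose (n - q)) = (n - r) * ((n - Suc r) choose (n - q))"
      using binomial_absorb_comp[of "n - r" "n - q"] by simp
    then show ?thesis unfolding \<phi>_def by (metis of_nat_mult)
  qed
  have up: "rk (insert x ?X) = Suc r" if "x \<in> B - D" for x
    using that matroid_rank_insert_le[of x ?X]
      matroid_rank_mono[of ?X "insert x ?X", OF subset_insertI]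
    by (auto simp: D_def r_def)
  have "B - S = (D - S) \<union> (B - D)" using SD DB by auto
  then have "(\<Sum>x\<in>B - S. pot q (insert x ?X))
      = (\<Sum>x\<in>D - S. pot q (insert x ?X)) + (\<Sum>x\<in>B - D. pot q (insert x ?X))"
    using fin finB by (simp add: sum.union_disjoint Diff_disjoint disjoint_iff)
  also have "(\<Sum>x\<in>D - S. pot q (insert x ?X)) = (\<Sum>x\<in>D - S. \<phi> r)"
    by (intro sum.cong) (auto simp: D_def \<phi>_def n_def r_def)
  also have "\<dots> = (real (card D) - l) * \<phi> r"
    using SD fin ld by (simp add: card_Diff_subset l_def)
  also have "(\<Sum>x\<in>B - D. pot q (insert x ?X)) = (\<Sum>x\<in>B - D. \<phi> (Suc r))"
    by (intro sum.cong) (auto simp: up \<phi>_def n_def)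
  also have "\<dots> = (real n - card D) * \<phi> (Suc r)"
    using DB fin dr rn B by (simp add: card_Diff_subset n_def)
  finally have sum_eq: "(\<Sum>x\<in>B - S. pot q (insert x ?X))
      = (real (card D) - l) * \<phi> r + (real n - card D) * \<phi> (Suc r)" .
  \<comment> \<open>The worst case is \<open>card D = r\<close>, because \<open>\<phi>\<close> is
    decreasing.\<close>
  have "(real r - card D) * \<phi> (Suc r) \<le> (real r - card D) * \<phi> r"
    using dr by (intro mult_left_mono \<phi>_anti) simp
  then have "(real (card D) - l) * \<phi> r + (real n - card D) * \<phi> (Suc r)
      \<le> (real r - l) * \<phi> r + (real n - r) * \<phi> (Suc r)"
    by (simp add: algebra_simps)
  also have "(real n - r) * \<phi> (Suc r) = real (q - r) * \<phi> r"
    using \<phi>_step rn by simp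
  \<comment> \<open>For \<open>r \<le> q\<close> the left side is \<open>(q - l) * \<phi> r\<close>,
    and drawing without replacement only helps: \<open>(q - l) / (n - l) \<le> q / n\<close>. For
    \<open>r > q\<close> the potential is zero.\<close>
  also have "(real r - l) * \<phi> r + real (q - r) * \<phi> r \<le> real (n - l) * (real q / real n) * \<phi> r"
  proof (cases "r \<le> q")
    case True
    have "real l * q \<le> real l * n" using q by (intro mult_left_mono) (auto simp: n_def)
    then have "real n * (real q - l) \<le> real (n - l) * q"
      using ln by (simp add: algebra_simps)
    then have "real q - l \<le> real (n - l) * (real q / real n)"
      using ln by (simp add: field_simps)
    then have "(real q - l) * \<phi> r \<le> real (n - l) * (real q / real n) * \<phi> r"
      by (intro mult_right_mono) (simp_all add: \<phi>_def)
    then show ?thesis using True by (simp add: algebra_simps)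
  next
    case False
    then have "\<phi> r = 0" using rn unfolding \<phi>_def by (simp add: binomial_eq_0)
    then show ?thesis by simp
  qed
  finally show ?thesis
    unfolding sum_eq by (simp add: \<phi>_def n_def r_def l_def)
qed

text \<open>The one-step bound iterated \<open>l\<close> times. The binomial factor is the number of
  summands, so the average shrinks by \<open>q / rk E\<close> per element.\<close>

lemma sum_potential_subsets_le:
  assumes B: "indep B" "card B = rk E" and q: "q \<le> rk E" and "l \<le> rk E"
  shows "(\<Sum>S | S \<subseteq> B \<and> card S = l. pot q (F \<union> S))
       \<le> real (rk E choose l) * (real q / real (rk E)) ^ l * pot q F"
  using \<open>l \<le> rk E\<close>
proof (induction l)
  case 0
  have "{S. S \<subseteq> B \<and> card S = 0} = {{}}"
    using B indep_finite finite_subset by fastforce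
  then show ?case by simp
next
  case (Suc l)
  let ?n = "rk E"
  have finB: "finite B" using B indep_finite by blast
  have "real (Suc l) * (\<Sum>S | S \<subseteq> B \<and> card S = Suc l. pot q (F \<union> S))
      = (\<Sum>S | S \<subseteq> B \<and> card S = l. \<Sum>x\<in>B - S. pot q (insert x (F \<union> S)))"
    by (subst times_sum_subsets_card_Suc[OF finB]) simp
  also have "\<dots> \<le> (\<Sum>S | S \<subseteq> B \<and> card S = l. real (?n - l) * (real q / real ?n) * pot q (F \<union> S))"
  proof (rule sum_mono)
    fix S assume "S \<in> {S. S \<subseteq> B \<and> card S = l}"
    then show "(\<Sum>x\<in>B - S. pot q (insert x (F \<union> S)))
        \<le> real (?n - l) * (real q / real ?n) * pot q (F \<union> S)"
      using sum_potential_insert_le[OF B, of S q F] q Suc.prems by auto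
  qed
  also have "\<dots> = real (?n - l) * (real q / real ?n) * (\<Sum>S | S \<subseteq> B \<and> card S = l. pot q (F \<union> S))"
    by (simp add: sum_distrib_left)
  also have "\<dots> \<le> real (?n - l) * (real q / real ?n)
      * (real (?n choose l) * (real q / real ?n) ^ l * pot q F)"
    using Suc by (intro mult_left_mono) auto
  also have "\<dots> = (real (?n - l) * real (?n choose l)) * (real q / real ?n) ^ Suc l * pot q F"
    by simp
  also have "real (?n - l) * real (?n choose l) = real (Suc l) * real (?n choose Suc l)"
  proof -
    have "(?n - l) * (?n choose l) = Suc l * (?n choose Suc l)"
      by (metis binomial_absorb_comp binomial_absorption mult.commute)
    then show ?thesis by (metis of_nat_mult)
  qed
  finally have "real (Suc l) * (\<Sum>S | S \<subseteq> B \<and> card S = Suc l. pot q (F \<union> S))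
      \<le> real (Suc l) * (real (?n choose Suc l) * (real q / real ?n) ^ Suc l * pot q F)"
    by (simp only: mult.assoc)
  then show ?case by (simp only: mult_le_cancel_left_pos of_nat_0_less_iff zero_less_Suc)
qed

lemma nn_integral_potential_uniform_subset_le:
  assumes B: "indep B" "card B = rk E" and q: "q \<le> rk E" and k: "k \<le> rk E"
  shows "(\<integral>\<^sup>+S. ennreal (pot q (F \<union> S)) \<partial>pmf_of_set {S. S \<subseteq> B \<and> card S = k})
       \<le> ennreal ((real q / real (rk E)) ^ k) * ennreal (pot q F)"
proof -
  let ?A = "{S. S \<subseteq> B \<and> card S = k}"
  have finB: "finite B" using B indep_finite by blast
  have card: "card ?A = rk E choose k" using n_subsets[OF finB, of k] B by simp
  have pos: "0 < rk E choose k" using k by simp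
  have A: "finite ?A" "?A \<noteq> {}" using finB card pos card_gt_0_iff[of ?A] by auto
  have "(\<integral>\<^sup>+S. ennreal (pot q (F \<union> S)) \<partial>pmf_of_set ?A)
      = ennreal ((\<Sum>S\<in>?A. pot q (F \<union> S)) / real (rk E choose k))"
    using A pos by (subst nn_integral_pmf_of_set)
      (auto simp: card sum_ennreal divide_ennreal ennreal_of_nat_eq_real_of_nat sum_nonneg)
  also have "\<dots> \<le> ennreal ((real q / real (rk E)) ^ k * pot q F)"
    using sum_potential_subsets_le[OF B q k, of F] pos
    by (intro ennreal_leI) (simp add: pos_divide_le_eq mult_ac)
  finally show ?thesis by (simp add: ennreal_mult)
qed

text \<open>By independence, one set \<open>S j = X\<close> can be integrated last: with
  \<open>X\<close> fixed, the others extend \<open>F \<union> X\<close>, so the induction needs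
  arbitrary \<open>F\<close>. Nonnegative integrals avoid integrability conditions.\<close>

lemma nn_integral_potential_Union_le:
  fixes B :: "'i \<Rightarrow> 'a set"
  assumes "finite J" and B: "\<And>i. i \<in> J \<Longrightarrow> indep (B i) \<and> card (B i) = rk E"
    and q: "q \<le> rk E" and k: "k \<le> rk E"
  shows "(\<integral>\<^sup>+S. ennreal (pot q (F \<union> (\<Union>i\<in>J. S i)))
           \<partial>Pi_pmf J {} (\<lambda>i. pmf_of_set {S. S \<subseteq> B i \<and> card S = k}))
       \<le> ennreal ((real q / real (rk E)) ^ (k * card J)) * ennreal (pot q F)"
  using assms(1,2)
proof (induction J arbitrary: F rule: finite_induct)
  case empty
  then show ?case by simp
next
  case (insert j J)
  let ?p = "\<lambda>i. pmf_of_set {S. S \<subseteq> B i \<and> card S = k}"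
  let ?c = "real q / real (rk E)"
  have "(\<integral>\<^sup>+S. ennreal (pot q (F \<union> (\<Union>i\<in>insert j J. S i))) \<partial>Pi_pmf (insert j J) {} ?p)
      = (\<integral>\<^sup>+X. \<integral>\<^sup>+S. ennreal (pot q (F \<union> (\<Union>i\<in>insert j J. (S(j := X)) i)))
            \<partial>Pi_pmf J {} ?p \<partial>?p j)"
    using insert.hyps by (subst Pi_pmf_insert') simp_all
  also have "\<dots> = (\<integral>\<^sup>+X. \<integral>\<^sup>+S. ennreal (pot q ((F \<union> X) \<union> (\<Union>i\<in>J. S i))) \<partial>Pi_pmf J {} ?p \<partial>?p j)"
  proof -
    have "F \<union> (\<Union>i\<in>insert j J. (S(j := X)) i) = (F \<union> X) \<union> (\<Union>i\<in>J. S i)" for S X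
      using insert.hyps by (auto split: if_splits)
    then show ?thesis by simp
  qed
  also have "\<dots> \<le> (\<integral>\<^sup>+X. ennreal (?c ^ (k * card J)) * ennreal (pot q (F \<union> X)) \<partial>?p j)"
    using insert.prems by (intro nn_integral_mono insert.IH) auto
  also have "\<dots> = ennreal (?c ^ (k * card J)) * (\<integral>\<^sup>+X. ennreal (pot q (F \<union> X)) \<partial>?p j)"
    by (rule nn_integral_cmult) simp
  also have "\<dots> \<le> ennreal (?c ^ (k * card J)) * (ennreal (?c ^ k) * ennreal (pot q F))"
    using insert.prems q k by (intro mult_left_mono nn_integral_potential_uniform_subset_le) auto
  also have "\<dots> = ennreal (?c ^ (k * card (insert j J))) * ennreal (pot q F)"
    using insert.hyps by (simp add: ennreal_mult[symmetric] power_add mult_ac)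
  finally show ?case .
qed

text \<open>Markov's inequality: the potential is at least 1 on the bad event, and its initial value
  is \<open>rk E choose q\<close>.\<close>

lemma prob_rank_Union_le:
  fixes B :: "'i \<Rightarrow> 'a set"
  assumes I: "finite I" "J \<subseteq> I" and B: "\<And>i. i \<in> I \<Longrightarrow> indep (B i) \<and> card (B i) = rk E"
    and q: "q \<le> rk E" and k: "k \<le> rk E"
  shows "measure_pmf.prob (Pi_pmf I {} (\<lambda>i. pmf_of_set {S. S \<subseteq> B i \<and> card S = k}))
           {S. rk (\<Union>i\<in>J. S i) \<le> q}
       \<le> real (rk E choose q) * (real q / real (rk E)) ^ (k * card J)"
proof -
  let ?p = "\<lambda>i. pmf_of_set {S. S \<subseteq> B i \<and> card S = k}"
  let ?bad = "{S. rk (\<Union>i\<in>J. S i) \<le> q}"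
  have J: "finite J" using I finite_subset by blast
  \<comment> \<open>The event depends only on the coordinates in \<open>J\<close>, so the marginal
    on \<open>J\<close> suffices.\<close>
  have "emeasure (Pi_pmf I {} ?p) ?bad = emeasure (Pi_pmf J {} ?p) ?bad"
    unfolding Pi_pmf_subset[OF I] by simp
  also have "\<dots> = (\<integral>\<^sup>+S. indicator ?bad S \<partial>Pi_pmf J {} ?p)" by simp
  also have "\<dots> \<le> (\<integral>\<^sup>+S. ennreal (pot q ({} \<union> (\<Union>i\<in>J. S i))) \<partial>Pi_pmf J {} ?p)"
  proof (rule nn_integral_mono)
    fix S :: "'i \<Rightarrow> 'a set"
    have "1 \<le> (rk E - rk (\<Union>i\<in>J. S i)) choose (rk E - q)" if "rk (\<Union>i\<in>J. S i) \<le> q"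
      using that by (simp add: Suc_le_eq)
    then show "indicator ?bad S \<le> ennreal (pot q ({} \<union> (\<Union>i\<in>J. S i)))"
      by (auto simp: indicator_def simp flip: ennreal_1 intro!: ennreal_leI)
  qed
  also have "\<dots> \<le> ennreal ((real q / real (rk E)) ^ (k * card J)) * ennreal (pot q {})"
    using I B q k by (intro nn_integral_potential_Union_le J) auto
  also have "pot q {} = real (rk E choose q)"
    using matroid_rank_le_card[of "{}"] q by (simp add: binomial_symmetric[of q])
  finally have "ennreal (measure_pmf.prob (Pi_pmf I {} ?p) ?bad)
      \<le> ennreal (real (rk E choose q) * (real q / real (rk E)) ^ (k * card J))"
    by (simp add: measure_pmf.emeasure_eq_measure ennreal_mult mult.commute)
  then show ?thesis by (simp add: ennreal_le_iff)
qed

end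

section \<open>Numerical estimates for the union bound\<close>

text \<open>A single term of the exponential series; at \<open>x = m\<close> it replaces Stirling's
  lower bound for \<open>fact m\<close>.\<close>

lemma power_divide_fact_le_exp:
  fixes x :: real
  assumes "0 \<le> x"
  shows "x ^ m / fact m \<le> exp x"
proof -
  have "(\<Sum>i\<in>{m}. x ^ i /\<^sub>R fact i) \<le> (\<Sum>i. x ^ i /\<^sub>R fact i)"
    using assms by (intro sum_le_suminf summable_exp_generic) auto
  then show ?thesis by (simp add: exp_def divide_inverse mult.commute)
qed

lemma binomial_le_power_divide_fact: "real (n choose m) \<le> real n ^ m / fact m"
proof -
  have "real ((n choose m) * fact m) \<le> real (n ^ m)"
    using binomial_fact_pow by (simp only: of_nat_le_iff)
  then show ?thesis by (simp add: field_simps)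
qed

lemma binomial_times_power_le_3_power:
  assumes "0 < n"
  shows "real (n choose m) * (real m / real n) ^ m \<le> 3 ^ m"
proof -
  have "real (n choose m) * (real m / real n) ^ m \<le> real n ^ m / fact m * (real m / real n) ^ m"
    by (intro mult_right_mono binomial_le_power_divide_fact) simp
  also have "\<dots> = real m ^ m / fact m" using assms by (simp add: power_divide)
  also have "\<dots> \<le> exp (real m)" by (rule power_divide_fact_le_exp) simp
  also have "\<dots> = exp 1 ^ m" by (simp add: exp_of_nat_mult[of m "1 :: real", simplified])
  also have "\<dots> \<le> 3 ^ m" by (intro power_mono exp_le) simp
  finally show ?thesis .
qed

lemma two_power_le_fact_Suc: "(2::real) ^ s \<le> fact (Suc s)"
proof (induction s)
  case (Suc s)
  have "(2::real) * 2 ^ s \<le> real (Suc (Suc s)) * fact (Suc s)"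
    using Suc by (intro mult_mono) auto
  then show ?case by (simp only: power_Suc fact_Suc)
qed simp

text \<open>With \<open>s = n - t\<close>, the power is at most
  \<open>exp (- (s + 1) * k * t / n)\<close>, and \<open>k * t / n \<ge> 2 * ln n\<close>. This
  beats the binomials, of order \<open>n ^ (2 * s + 1)\<close>, by one factor \<open>n\<close>; the
  factorials supply the geometric decay.\<close>

lemma union_bound_term_large:
  assumes t: "1 \<le> t" "t \<le> n" "2 * n \<le> 3 * t" and k: "3 * ln (real n) \<le> real k"
  shows "real (n choose t) * real (n choose (t - 1)) * (real (t - 1) / real n) ^ (k * t)
       \<le> (1 / 2) ^ (n - t) / real n"
proof -
  define s where "s = n - t"
  have n: "0 < n" using t by simp
  have "real (t - 1) / real n = 1 + - (real (Suc s) / real n)"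
    using t n by (simp add: s_def field_simps)
  also have "\<dots> \<le> exp (- (real (Suc s) / real n))" by (rule exp_ge_add_one_self)
  finally have "(real (t - 1) / real n) ^ (k * t) \<le> exp (- (real (Suc s) / real n)) ^ (k * t)"
    by (intro power_mono) auto
  also have "\<dots> = exp (- (real (Suc s) * real k * real t / real n))"
    by (simp add: exp_of_nat_mult[symmetric] mult_ac)
  also have "\<dots> \<le> exp (- (real (Suc s) * 2 * ln (real n)))"
  proof -
    \<comment> \<open>The 3 comes from the sample size, the 2/3 from the threshold for
      \<open>t / n\<close>.\<close>
    have "2 * ln (real n) = 3 * ln (real n) * (2 / 3)" by simp
    also have "\<dots> \<le> real k * (real t / real n)"
      using k t n by (intro mult_mono) (auto simp: field_simps)
    finally have "real (Suc s) * (2 * ln (real n)) \<le> real (Suc s) * (real k * (real t / real n))"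
      by (intro mult_left_mono) auto
    then show ?thesis by (simp only: mult.assoc times_divide_eq_right exp_le_cancel_iff neg_le_iff_le)
  qed
  also have "\<dots> = 1 / real n ^ (2 * Suc s)"
    using n by (simp add: exp_minus inverse_eq_divide ln_realpow[symmetric] mult.commute
        flip: ln_realpow[of "real n" "2 * Suc s", simplified])
  finally have pow: "(real (t - 1) / real n) ^ (k * t) \<le> 1 / real n ^ (2 * Suc s)" .
  have "n choose t = n choose s" "n choose (t - 1) = n choose Suc s"
    using t binomial_symmetric[of t n] binomial_symmetric[of "t - 1" n] by (auto simp: s_def Suc_diff_le)
  then have "real (n choose t) * real (n choose (t - 1)) * (real (t - 1) / real n) ^ (k * t)
      \<le> (real n ^ s / fact s) * (real n ^ Suc s / fact (Suc s)) * (1 / real n ^ (2 * Suc s))"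
    using pow by (intro mult_mono) (simp_all add: binomial_le_power_divide_fact del: fact_Suc power_Suc)
  also have "\<dots> = 1 / real n * (1 / fact s) * (1 / fact (Suc s))"
    using n by (simp add: field_simps power_add mult_2_right del: fact_Suc)
  also have "\<dots> \<le> 1 / real n * 1 * (1 / 2 ^ s)"
    using two_power_le_fact_Suc[of s] n by (intro mult_mono divide_left_mono) (auto simp del: fact_Suc)
  finally show ?thesis by (simp add: s_def power_divide mult.commute)
qed

text \<open>Each binomial absorbs \<open>t\<close> of the \<open>k * t\<close> factors and costs at
  most \<open>3 ^ t\<close>. At least \<open>7 * t\<close> factors, each at most 2/3, remain, and
  \<open>9 * (2 / 3) ^ 7 < 3 / 5\<close>.\<close>

lemma union_bound_term_small:
  assumes t: "1 \<le> t" "3 * t < 2 * n" and k: "9 \<le> k"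
  shows "real (n choose t) * real (n choose (t - 1)) * (real (t - 1) / real n) ^ (k * t) \<le> (3 / 5) ^ t"
proof -
  define x where "x = real (t - 1) / real n"
  have n: "0 < n" using t by simp
  have x: "0 \<le> x" "x \<le> real t / real n" "x \<le> 2 / 3"
    using t n by (auto simp: x_def field_simps)
  have "k * t = t + t + (k - 2) * t" using k by (simp add: diff_mult_distrib)
  then have "real (n choose t) * real (n choose (t - 1)) * x ^ (k * t)
      = (real (n choose t) * x ^ t) * (real (n choose (t - 1)) * x ^ t) * (x ^ (k - 2)) ^ t"
    by (simp add: power_add power_mult)
  also have "\<dots> \<le> 3 ^ t * 3 ^ t * ((2 / 3) ^ 7) ^ t"
  proof (intro mult_mono)
    have "real (n choose t) * x ^ t \<le> real (n choose t) * (real t / real n) ^ t"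
      using x by (intro mult_left_mono power_mono) auto
    also have "\<dots> \<le> 3 ^ t" by (rule binomial_times_power_le_3_power[OF n])
    finally show "real (n choose t) * x ^ t \<le> 3 ^ t" .
    have "real (n choose (t - 1)) * x ^ t \<le> real (n choose (t - 1)) * x ^ (t - 1)"
      using x by (intro mult_left_mono power_decreasing) auto
    also have "\<dots> \<le> 3 ^ (t - 1)" unfolding x_def by (rule binomial_times_power_le_3_power[OF n])
    also have "\<dots> \<le> 3 ^ t" by (rule power_increasing) auto
    finally show "real (n choose (t - 1)) * x ^ t \<le> 3 ^ t" .
    have "x ^ (k - 2) \<le> x ^ 7" using x k by (intro power_decreasing) auto
    also have "\<dots> \<le> (2 / 3) ^ 7" using x by (intro power_mono) auto
    finally show "(x ^ (k - 2)) ^ t \<le> ((2 / 3) ^ 7) ^ t" using x by (intro power_mono) auto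
  qed (use x in auto)
  also have "\<dots> = (3 * 3 * (2 / 3) ^ 7) ^ t" by (simp only: power_mult_distrib)
  also have "\<dots> \<le> (3 / 5) ^ t" by (intro power_mono) (auto simp: power_divide)
  finally show ?thesis unfolding x_def .
qed

lemma sum_power_le:
  fixes c :: real
  assumes "0 \<le> c" "c < 1" "finite T" "\<And>t. t \<in> T \<Longrightarrow> m \<le> t"
  shows "(\<Sum>t\<in>T. c ^ t) \<le> c ^ m / (1 - c)"
proof -
  have "(\<Sum>t\<in>T. c ^ t) = (\<Sum>j\<in>(\<lambda>t. t - m) ` T. c ^ m * c ^ j)"
    using assms(4) by (intro sum.reindex_cong[symmetric, of "\<lambda>t. t - m" T])
      (auto simp: inj_on_def power_add[symmetric] eq_diff_iff)
  also have "\<dots> = c ^ m * (\<Sum>j\<in>(\<lambda>t. t - m) ` T. c ^ j)" by (simp add: sum_distrib_left)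
  also have "\<dots> \<le> c ^ m * (\<Sum>j. c ^ j)"
    using assms by (intro mult_left_mono sum_le_suminf summable_geometric) auto
  also have "\<dots> = c ^ m / (1 - c)" using assms by (simp add: suminf_geometric)
  finally show ?thesis .
qed

text \<open>No index remains if \<open>k = n\<close>. Otherwise \<open>n \<ge> 7\<close>; the terms
  with \<open>t \<ge> 2 * n / 3\<close> contribute at most 2/7 and the others at most 1/7.\<close>

lemma union_bound_sum_le_half:
  assumes n: "2 \<le> n" and k: "k = min (3 * nat \<lceil>ln (real n)\<rceil>) n"
  shows "(\<Sum>t\<in>{k<..n}. real (n choose t) * real (n choose (t - 1)) * (real (t - 1) / real n) ^ (k * t))
       \<le> 1 / 2"
proof (cases "k < n")
  case False
  then have "{k<..n} = {}" by auto
  then show ?thesis by simp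
next
  case True
  define c where "c = nat \<lceil>ln (real n)\<rceil>"
  have kc: "k = 3 * c" using True k by (simp add: c_def min_def split: if_splits)
  have ln0: "0 < ln (real n)" using n by simp
  have lnc: "ln (real n) \<le> real c" unfolding c_def using ln0 by linarith
  have nexp: "real n \<le> 3 ^ c"
  proof -
    have "real n = exp (ln (real n))" using n by simp
    also have "\<dots> \<le> exp (real c)" using lnc by simp
    also have "\<dots> = exp 1 ^ c" by (simp add: exp_of_nat_mult[of c "1 :: real", simplified])
    also have "\<dots> \<le> 3 ^ c" by (intro power_mono exp_le) simp
    finally show ?thesis .
  qed
  \<comment> \<open>Here \<open>k = 3 * c < n \<le> 3 ^ c\<close>, which fails for
    \<open>c = 1\<close>; \<open>c = 0\<close> contradicts \<open>n \<ge> 2\<close>.\<close>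
  have c2: "2 \<le> c"
  proof (rule ccontr)
    assume "\<not> 2 \<le> c"
    then have "c = 0 \<or> c = 1" by auto
    then show False using nexp True kc n by auto
  qed
  then have n7: "7 \<le> n" using True kc by simp
  have k3: "3 * ln (real n) \<le> real k" using lnc kc by simp
  define T where "T t = real (n choose t) * real (n choose (t - 1)) * (real (t - 1) / real n) ^ (k * t)" for t
  let ?L = "{t \<in> {k<..n}. 2 * n \<le> 3 * t}" and ?S = "{t \<in> {k<..n}. 3 * t < 2 * n}"
  have "{k<..n} = ?L \<union> ?S" by auto
  moreover have "?L \<inter> ?S = {}" by auto
  moreover have "finite ?L" "finite ?S" by auto
  ultimately have "(\<Sum>t\<in>{k<..n}. T t) = (\<Sum>t\<in>?L. T t) + (\<Sum>t\<in>?S. T t)"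
    using sum.union_disjoint[of ?L ?S T] by metis
  also have "(\<Sum>t\<in>?L. T t) \<le> 2 / 7"
  proof -
    have "(\<Sum>t\<in>?L. T t) \<le> (\<Sum>t\<in>?L. (1 / 2) ^ (n - t) / real n)"
      unfolding T_def using k3 by (intro sum_mono union_bound_term_large) auto
    also have "\<dots> = (\<Sum>s\<in>(\<lambda>t. n - t) ` ?L. (1 / 2) ^ s) / real n"
      by (subst sum.reindex) (auto simp: inj_on_def sum_divide_distrib)
    also have "\<dots> \<le> 2 / real n"
      using sum_power_le[of "1 / 2" "(\<lambda>t. n - t) ` ?L" 0] by (intro divide_right_mono) auto
    also have "\<dots> \<le> 2 / 7" using n7 by (simp add: field_simps)
    finally show ?thesis .
  qed
  also have "(\<Sum>t\<in>?S. T t) \<le> 1 / 7"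
  proof (cases "c = 2")
    \<comment> \<open>Now \<open>k = 6\<close>, so \<open>t \<ge> 7\<close> and
      \<open>3 * t \<ge> 21 > 18 \<ge> 2 * n\<close>.\<close>
    case True
    then have "real n \<le> 9" using nexp by simp
    then have "?S = {}" using kc True by auto
    then show ?thesis by (simp only: sum.empty)
  next
    case False
    then have k9: "9 \<le> k" using c2 kc by simp
    have "(\<Sum>t\<in>?S. T t) \<le> (\<Sum>t\<in>?S. (3 / 5) ^ t)"
      unfolding T_def using k9 by (intro sum_mono union_bound_term_small) auto
    also have "\<dots> \<le> (3 / 5) ^ 9 / (1 - 3 / 5)" using k9 by (intro sum_power_le) auto
    also have "\<dots> \<le> 1 / 7" by (simp add: power_divide)
    finally show ?thesis .
  qed
  finally show ?thesis unfolding T_def by simp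
qed

section \<open>Transversal bases and the final union bound\<close>

lemma sum_Pow_card:
  fixes g :: "nat \<Rightarrow> real"
  assumes "finite I"
  shows "(\<Sum>J | J \<subseteq> I \<and> card J \<in> T. g (card J)) = (\<Sum>t\<in>T \<inter> {..card I}. real (card I choose t) * g t)"
proof -
  have "(\<Sum>J | J \<subseteq> I \<and> card J \<in> T. g (card J))
      = (\<Sum>t\<in>T \<inter> {..card I}. \<Sum>J | J \<in> {J. J \<subseteq> I \<and> card J \<in> T} \<and> card J = t. g (card J))"
    using assms by (intro sum.group[symmetric]) (auto intro: card_mono)
  also have "\<dots> = (\<Sum>t\<in>T \<inter> {..card I}. \<Sum>J | J \<subseteq> I \<and> card J = t. g t)"
    by (intro sum.cong) auto
  also have "\<dots> = (\<Sum>t\<in>T \<inter> {..card I}. real (card I choose t) * g t)"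
    using n_subsets[OF assms] by simp
  finally show ?thesis .
qed

text \<open>Rado's theorem yields \<open>n\<close> independent representatives, a basis by
  cardinality; disjointness of the \<open>S i\<close> makes it meet each of them only once.\<close>

lemma has_transversal_basis_if_rank:
  assumes M: "matroid E indep" and n: "matroid_rank E indep = n"
    and disj: "disjoint_family_on S {1..n}" and fin: "\<And>i. i \<in> {1..n} \<Longrightarrow> finite (S i)"
    and rank: "\<And>J. J \<subseteq> {1..n} \<Longrightarrow> card J \<le> matroid_rank (\<Union>i\<in>J. S i) indep"
  shows "has_transversal_basis E indep n S"
proof -
  obtain f where f: "\<And>i. i \<in> {1..n} \<Longrightarrow> f i \<in> S i" "inj_on f {1..n}" "indep (f ` {1..n})"
    using Rado[OF M, of "{1..n}" S] fin rank by blast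
  have "matroid_basis E indep (f ` {1..n})"
    using f n by (intro matroid_basis_of_card[OF M]) (auto simp: card_image)
  moreover have "f ` {1..n} \<subseteq> (\<Union>i\<in>{1..n}. S i)" using f(1) by blast
  moreover have "card (f ` {1..n} \<inter> S i) = 1" if "i \<in> {1..n}" for i
  proof -
    have "j = i" if "j \<in> {1..n}" "f j \<in> S i" for j
      using disjoint_family_onD[OF disj that(1) \<open>i \<in> {1..n}\<close>] f(1)[OF that(1)] that(2) by blast
    then have "f ` {1..n} \<inter> S i = {f i}" using f(1)[OF that] that by blast
    then show ?thesis by simp
  qed
  ultimately show ?thesis unfolding has_transversal_basis_def by blast
qed

text \<open>The minimum in \<open>k\<close> covers small \<open>n\<close>, such as 2, for which
  \<open>\<alpha>\<close> exceeds \<open>n\<close>; then the only choice is the whole basis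
  \<open>B i\<close>.\<close>

theorem theorem1p3:
  fixes E :: "'a set" and indep :: "'a set \<Rightarrow> bool" and n :: nat and B :: "nat \<Rightarrow> 'a set"
  assumes "matroid E indep"
    and "matroid_rank E indep = n"
    and "n \<ge> 2"
    and "\<forall>i\<in>{1..n}. matroid_basis E indep (B i)"
    and "disjoint_family_on B {1..n}"
  defines "\<alpha> \<equiv> 3 * nat \<lceil>ln (real n)\<rceil>"
  defines "k \<equiv> min \<alpha> n"
  shows "measure_pmf.prob
           (Pi_pmf {1..n} {} (\<lambda>i. pmf_of_set {S. S \<subseteq> B i \<and> card S = k}))
           {S. has_transversal_basis E indep n S} \<ge> 1/2"
proof -
  let ?P = "Pi_pmf {1..n} {} (\<lambda>i. pmf_of_set {S. S \<subseteq> B i \<and> card S = k})"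
  \<comment> \<open>The truncated \<open>card J - 1\<close> is harmless: every \<open>J\<close> in
    \<open>?Js\<close> has more than \<open>k\<close> elements, hence at least one.\<close>
  let ?bad = "\<lambda>J. {S. matroid_rank (\<Union>i\<in>J. S i) indep \<le> card J - 1}"
  let ?Js = "{J. J \<subseteq> {1..n} \<and> card J \<in> {k<..n}}"
  note M = assms(1)
  have B: "indep (B i) \<and> card (B i) = matroid_rank E indep" if "i \<in> {1..n}" for i
    using assms(2,4) that matroid_basis_card[OF M] unfolding matroid_basis_def by auto
  have kn: "k \<le> n" by (simp add: k_def)
  have supp: "S i \<subseteq> B i \<and> card (S i) = k" if "S \<in> set_pmf ?P" "i \<in> {1..n}" for S i
  proof -
    let ?A = "{X. X \<subseteq> B i \<and> card X = k}"
    have finB: "finite (B i)" using B[OF that(2)] indep_finite[OF M] by blast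
    then have "card ?A > 0" using n_subsets[OF finB, of k] B[OF that(2)] kn assms(2) by simp
    then have "set_pmf (pmf_of_set ?A) = ?A" using card_gt_0_iff[of ?A] by (intro set_pmf_of_set) auto
    then show ?thesis
      using that set_Pi_pmf_subset'[of "{1..n}" "{}" "\<lambda>i. pmf_of_set {S. S \<subseteq> B i \<and> card S = k}"]
      by (auto simp: PiE_dflt_def)
  qed
  \<comment> \<open>Restricting to the support guarantees that each \<open>S i\<close> is a
    \<open>k\<close>-subset of \<open>B i\<close>, hence independent.\<close>
  have "- {S. has_transversal_basis E indep n S} \<inter> set_pmf ?P \<subseteq> (\<Union>J\<in>?Js. ?bad J)"
  proof
    fix S assume S: "S \<in> - {S. has_transversal_basis E indep n S} \<inter> set_pmf ?P"
    have SB: "S i \<subseteq> B i" "card (S i) = k" if "i \<in> {1..n}" for i using supp S that by auto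
    have ind: "indep (S i)" if "i \<in> {1..n}" for i
      using SB[OF that] B[OF that] indep_subset[OF M] by blast
    have "disjoint_family_on S {1..n}"
      using assms(5) SB unfolding disjoint_family_on_def by blast
    moreover have "finite (S i)" if "i \<in> {1..n}" for i using ind[OF that] by (rule indep_finite[OF M])
    ultimately obtain J where J: "J \<subseteq> {1..n}" "matroid_rank (\<Union>i\<in>J. S i) indep < card J"
      using has_transversal_basis_if_rank[OF M assms(2), of S] S not_le by blast
    then obtain j where j: "j \<in> J" by fastforce
    \<comment> \<open>A single \<open>S j\<close> already has rank \<open>k\<close>, so a violating
      \<open>J\<close> must have more than \<open>k\<close> elements.\<close>
    then have "k = matroid_rank (S j) indep" using J SB ind matroid_rank_indep[OF M] by auto
    also have "\<dots> \<le> matroid_rank (\<Union>i\<in>J. S i) indep" using j by (intro matroid_rank_mono[OF M]) auto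
    finally have "k < card J" using J by simp
    moreover have "card J \<le> n" using card_mono[OF _ J(1)] by simp
    ultimately show "S \<in> (\<Union>J\<in>?Js. ?bad J)" using J by auto
  qed
  then have "measure_pmf.prob ?P (- {S. has_transversal_basis E indep n S})
      \<le> measure_pmf.prob ?P (\<Union>J\<in>?Js. ?bad J)"
    by (subst measure_Int_set_pmf[symmetric]) (auto intro!: measure_pmf.finite_measure_mono)
  also have "\<dots> \<le> (\<Sum>J\<in>?Js. measure_pmf.prob ?P (?bad J))"
    by (intro measure_pmf.finite_measure_subadditive_finite) auto
  also have "\<dots> \<le> (\<Sum>J\<in>?Js. real (n choose (card J - 1)) * (real (card J - 1) / real n) ^ (k * card J))"
  proof (rule sum_mono)
    fix J assume "J \<in> ?Js"
    then have "J \<subseteq> {1..n}" "card J - 1 \<le> n" by auto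
    then show "measure_pmf.prob ?P (?bad J)
        \<le> real (n choose (card J - 1)) * (real (card J - 1) / real n) ^ (k * card J)"
      using prob_rank_Union_le[OF M, where I = "{1..n}" and J = J and B = B and k = k and q = "card J - 1"]
        B kn unfolding assms(2) by blast
  qed
  also have "\<dots> = (\<Sum>t\<in>{k<..n}. real (n choose t) * real (n choose (t - 1)) * (real (t - 1) / real n) ^ (k * t))"
    by (subst sum_Pow_card[where g = "\<lambda>t. real (n choose (t - 1)) * (real (t - 1) / real n) ^ (k * t)"])
       (auto intro!: sum.cong simp: mult.assoc)
  also have "\<dots> \<le> 1 / 2"
    using assms(3) by (intro union_bound_sum_le_half) (simp_all add: k_def \<alpha>_def)
  finally show ?thesis
    using measure_pmf.prob_compl[of "{S. has_transversal_basis E indep n S}" ?P]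
    by (simp add: Compl_eq_Diff_UNIV)
qed

end
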